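(* Let $s,n$ be positive integers, $G$ a finite abelian group and $P\subset G^{s\times n}$ a subgroup. Then the following identity holds in $\mathbb{C}[x_{i,j}(h) : 1\le i\le s,\,1\le j\le n,\,h\in G^\vee]$: $$GW_{P^\perp}(x_{i,j}(h))=\frac1{|P|}\,GW^*_P(\text{substituted}),$$ where on the right-hand side every indeterminate $x_{*i,j}(g)$ ($1\le i\le s$, $1\le j\le n$, $g\in G$) is substituted by $$x_{*i,j}(g)\leftarrow\sum_{h\in G^\vee}(h\bullet g)\,x_{i,j}(h).$$
   Context: $G^\vee=\mathrm{Hom}(G,T)$, with $T=\{z\in\mathbb{C}:|z|=1\}$, is the character group of $G$, written additively (with $0$ the trivial character), and $h\bullet g:=h(g)$ for $h\in G^\vee$, $g\in G$. $G^{s\times n}$ is the group of $s\times n$ matrices with entries in $G$. Its character group is identified with $(G^\vee)^{s\times n}$ via $A\bullet B=\prod_{i,j}a_{i,j}\bullet b_{i,j}$. For a subgroup $P\subset G^{s\times n}$, $P^\perp=\{A\in(G^\vee)^{s\times n}:A\bullet B=1\text{ for all }B\in P\}$. The complete weight enumerator polynomials are $$GW_{P^\perp}(x_{i,j}(h))=\sum_{A\in P^\perp}\prod_{1\le i\le s,\,1\le j\le n}x_{i,j}(a_{i,j}),\qquad GW^*_P(x_{*i,j}(g))=\sum_{B\in P}\prod_{1\le i\le s,\,1\le j\le n}x_{*i,j}(b_{i,j}),$$ where $x_{i,j}(h)$ ($h\in G^\vee$) and $x_{*i,j}(g)$ ($g\in G$) are two families of independent indeterminates over $\mathbb{C}$.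 *)

theory Defs
  imports
    Complex_Main
    "HOL-Library.Poly_Mapping"
    "HOL-Algebra.Product_Groups"
begin

subsection \<open>Characters\<close>

definition circle_group :: "complex monoid"
  where "circle_group = \<lparr>carrier = {z. norm z = 1}, monoid.mult = (*), one = 1\<rparr>"

text \<open>
  The set \<open>hom G circle_group\<close> constrains its elements on \<open>carrier G\<close> only, so characters are
  taken to be \<open>extensional\<close>; otherwise one character would be counted many times.
\<close>

definition char_group :: "('a, 'b) monoid_scheme \<Rightarrow> ('a \<Rightarrow> complex) monoid"
  where "char_group G =
    \<lparr>carrier = hom G circle_group \<inter> extensional (carrier G),
     monoid.mult = (\<lambda>h h'. \<lambda>g\<in>carrier G. h g \<otimes>\<^bsub>circle_group\<^esub> h' g),
     one = (\<lambda>g\<in>carrier G. \<one>\<^bsub>circle_group\<^esub>)\<rparr>"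

definition pairing :: "('a \<Rightarrow> complex) \<Rightarrow> 'a \<Rightarrow> complex"
  where "pairing h g = h g"


subsection \<open>Matrices over a group\<close>

definition matrix_indices :: "nat \<Rightarrow> nat \<Rightarrow> (nat \<times> nat) set"
  where "matrix_indices s n = {1..s} \<times> {1..n}"

definition matrix_group ::
    "nat \<Rightarrow> nat \<Rightarrow> ('a, 'b) monoid_scheme \<Rightarrow> (nat \<times> nat \<Rightarrow> 'a) monoid"
  where "matrix_group s n G = product_group (matrix_indices s n) (\<lambda>_. G)"

definition matrix_pairing ::
    "nat \<Rightarrow> nat \<Rightarrow> (nat \<times> nat \<Rightarrow> 'a \<Rightarrow> complex) \<Rightarrow> (nat \<times> nat \<Rightarrow> 'a) \<Rightarrow> complex"
  where "matrix_pairing s n A B = (\<Prod>(i, j)\<in>matrix_indices s n. pairing (A (i, j)) (B (i, j)))"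

definition annihilator ::
    "nat \<Rightarrow> nat \<Rightarrow> ('a, 'b) monoid_scheme \<Rightarrow> (nat \<times> nat \<Rightarrow> 'a) set
      \<Rightarrow> (nat \<times> nat \<Rightarrow> 'a \<Rightarrow> complex) set"
  where "annihilator s n G P =
    {A \<in> carrier (matrix_group s n (char_group G)). \<forall>B\<in>P. matrix_pairing s n A B = 1}"


subsection \<open>Multivariate polynomials over the complex numbers\<close>

text \<open>
  Monomials are finitely supported exponent functions, and a polynomial is a finitely supported
  map from monomials to coefficients; the multiplication on \<^typ>\<open>('v \<Rightarrow>\<^sub>0 nat) \<Rightarrow>\<^sub>0 complex\<close>
  is convolution.
\<close>

type_synonym 'v complex_mpoly = "('v \<Rightarrow>\<^sub>0 nat) \<Rightarrow>\<^sub>0 complex"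

definition mpoly_const :: "complex \<Rightarrow> 'v complex_mpoly"
  where "mpoly_const c = Poly_Mapping.single 0 c"

definition mpoly_var :: "'v \<Rightarrow> 'v complex_mpoly"
  where "mpoly_var v = Poly_Mapping.single (Poly_Mapping.single v 1) 1"

definition mpoly_subst :: "('v \<Rightarrow> 'w complex_mpoly) \<Rightarrow> 'v complex_mpoly \<Rightarrow> 'w complex_mpoly"
  where "mpoly_subst \<sigma> p =
    (\<Sum>m\<in>Poly_Mapping.keys p. mpoly_const (Poly_Mapping.lookup p m) *
       (\<Prod>v\<in>Poly_Mapping.keys m. \<sigma> v ^ Poly_Mapping.lookup m v))"

lemma mpoly_subst_const [simp]: "mpoly_subst \<sigma> (mpoly_const c) = mpoly_const c"
  by (simp add: mpoly_subst_def mpoly_const_def)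

lemma mpoly_subst_var [simp]: "mpoly_subst \<sigma> (mpoly_var v) = \<sigma> v"
  by (simp add: mpoly_subst_def mpoly_const_def mpoly_var_def)


subsection \<open>Complete weight enumerators\<close>

text \<open>
  The indeterminate \<open>(i, j, a)\<close> is attached to the entry \<open>a\<close> in position \<open>(i, j)\<close>.
  With \<open>'a\<close> the type of characters this is \<open>GW\<close> in the indeterminates \<open>x\<^sub>i\<^sub>j(h)\<close>; with \<open>'a\<close> the
  type of group elements it is the starred enumerator in the indeterminates \<open>x\<^sub>*\<^sub>i\<^sub>j(g)\<close>.
  The two families of indeterminates live in different polynomial types.
\<close>

definition weight_enumerator ::
    "nat \<Rightarrow> nat \<Rightarrow> (nat \<times> nat \<Rightarrow> 'a) set \<Rightarrow> (nat \<times> nat \<times> 'a) complex_mpoly"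
  where "weight_enumerator s n M =
    (\<Sum>A\<in>M. \<Prod>(i, j)\<in>matrix_indices s n. mpoly_var (i, j, A (i, j)))"

end

theory Submission
  imports
    Defs
    "HOL-Algebra.Multiplicative_Group"
begin

text \<open>
  The identity is Poisson summation over the subgroup \<open>P\<close>, applied coefficientwise. Substituting
  \<open>\<Sum>h. (h \<bullet> g) x\<^sub>i\<^sub>j(h)\<close> into the monomial of a matrix \<open>B\<close> gives a product, over the positions
  \<open>(i, j)\<close>, of sums over characters. Multiplied out, this is a sum over all choices of one
  character per position, that is, over all matrices \<open>A\<close> of characters, and the term of \<open>A\<close> is
  \<open>A \<bullet> B\<close> times the monomial of \<open>A\<close>. After summing over \<open>B \<in> P\<close> and exchanging the sums, the
  monomial of \<open>A\<close> has the coefficient \<open>\<Sum>B\<in>P. A \<bullet> B\<close>. Since \<open>B \<mapsto> A \<bullet> B\<close> is a homomorphism,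
  orthogonality (\<open>sum_matrix_pairing\<close>) makes this coefficient \<open>card P\<close> when \<open>A\<close> annihilates \<open>P\<close>
  and \<open>0\<close> otherwise. Division by \<open>card P\<close> leaves exactly the monomials of the annihilator.

  Two points of bookkeeping support this. The monomial of a matrix contains each of its
  indeterminates once, because the position is part of the indeterminate; so the substitution
  acts on it factor by factor (\<open>mpoly_subst_squarefree\<close>). And the character group has to be finite
  (\<open>finite_char_group\<close>), since a sum over an infinite set is \<open>0\<close> by convention.
\<close>

lemma mpoly_const_mult: "mpoly_const (a * b) = mpoly_const a * mpoly_const b"
  by (simp add: mpoly_const_def mult_single)

lemma mpoly_const_0 [simp]: "mpoly_const 0 = 0"
  by (simp add: mpoly_const_def)

lemma mpoly_const_1 [simp]: "mpoly_const 1 = 1"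
  by (simp add: mpoly_const_def)

lemma mpoly_const_add: "mpoly_const (a + b) = mpoly_const a + mpoly_const b"
  by (simp add: mpoly_const_def single_add)

lemma mpoly_const_sum: "mpoly_const (\<Sum>x\<in>X. f x) = (\<Sum>x\<in>X. mpoly_const (f x))"
  by (induction X rule: infinite_finite_induct) (simp_all add: mpoly_const_add)

lemma mpoly_const_prod: "mpoly_const (\<Prod>x\<in>X. f x) = (\<Prod>x\<in>X. mpoly_const (f x))"
  by (induction X rule: infinite_finite_induct) (simp_all add: mpoly_const_mult)

text \<open>
  The index set of the sum that defines \<^const>\<open>mpoly_subst\<close> depends on the polynomial. To compare
  the substitutions of several polynomials, all of them are summed over a common set.
\<close>

lemma mpoly_subst_eq_sum:
  assumes "finite K" and "Poly_Mapping.keys p \<subseteq> K"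
  shows "mpoly_subst \<sigma> p =
    (\<Sum>m\<in>K. mpoly_const (Poly_Mapping.lookup p m) *
       (\<Prod>v\<in>Poly_Mapping.keys m. \<sigma> v ^ Poly_Mapping.lookup m v))"
  unfolding mpoly_subst_def
  using assms by (intro sum.mono_neutral_left) (auto simp: in_keys_iff)

lemma mpoly_subst_add: "mpoly_subst \<sigma> (p + q) = mpoly_subst \<sigma> p + mpoly_subst \<sigma> q"
proof -
  let ?K = "Poly_Mapping.keys p \<union> Poly_Mapping.keys q"
  have "Poly_Mapping.keys (p + q) \<subseteq> ?K"
    by (rule Poly_Mapping.keys_add)
  then show ?thesis
    by (simp add: mpoly_subst_eq_sum[of ?K] lookup_add mpoly_const_add algebra_simps
        sum.distrib)
qed

lemma mpoly_subst_sum: "mpoly_subst \<sigma> (\<Sum>x\<in>X. p x) = (\<Sum>x\<in>X. mpoly_subst \<sigma> (p x))"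
proof (induction X rule: infinite_finite_induct)
  case (insert x X)
  then show ?case by (simp add: mpoly_subst_add)
qed (simp_all add: mpoly_subst_def)

text \<open>
  Injectivity of \<open>v\<close> makes all exponents of the product equal to \<open>0\<close> or \<open>1\<close>, so that the product
  over the support of the monomial runs through each factor once.
\<close>

lemma mpoly_subst_squarefree:
  assumes "finite I" and "inj_on v I"
  shows "mpoly_subst \<sigma> (\<Prod>i\<in>I. mpoly_var (v i)) = (\<Prod>i\<in>I. \<sigma> (v i))"
proof -
  define m where "m = (\<Sum>i\<in>I. Poly_Mapping.single (v i) (1::nat))"
  have monomial: "(\<Prod>i\<in>I. mpoly_var (v i)) = Poly_Mapping.single m 1"
    unfolding m_def using assms(1)
    by (induction I) (simp_all add: mpoly_var_def mult_single)
  have lookup_m: "Poly_Mapping.lookup m w = (if w \<in> v ` I then 1 else 0)" for w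
  proof -
    have "Poly_Mapping.lookup m w = (\<Sum>i\<in>I. if v i = w then 1 else (0::nat))"
      by (simp add: m_def lookup_sum lookup_single when_def del: One_nat_def)
    also have "\<dots> = (\<Sum>u\<in>v ` I. if u = w then 1 else 0)"
      by (simp add: sum.reindex[OF assms(2)])
    finally show ?thesis
      using assms(1) by simp
  qed
  then have "Poly_Mapping.keys m = v ` I"
    by (auto simp: in_keys_iff split: if_splits)
  then show ?thesis
    using assms(2) by (simp add: monomial mpoly_subst_def lookup_m prod.reindex)
qed

lemma char_group_mult:
  assumes "h \<in> carrier (char_group G)" "x \<in> carrier G" "y \<in> carrier G"
  shows "h (x \<otimes>\<^bsub>G\<^esub> y) = h x * h y"
  using assms by (auto simp: char_group_def circle_group_def hom_def)

lemma char_group_norm: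
  assumes "h \<in> carrier (char_group G)" "x \<in> carrier G"
  shows "norm (h x) = 1"
  using assms by (auto simp: char_group_def circle_group_def hom_def)

lemma char_group_pow:
  assumes "group G" "h \<in> carrier (char_group G)" "x \<in> carrier G"
  shows "h (x [^]\<^bsub>G\<^esub> (k::nat)) = h x ^ k"
proof -
  interpret group G by fact
  \<comment> \<open>An idempotent complex number of norm \<open>1\<close> is \<open>1\<close>.\<close>
  have "h \<one>\<^bsub>G\<^esub> * h \<one>\<^bsub>G\<^esub> = h \<one>\<^bsub>G\<^esub>" "norm (h \<one>\<^bsub>G\<^esub>) = 1"
    using char_group_mult[OF assms(2) one_closed one_closed]
      char_group_norm[OF assms(2) one_closed] by simp_all
  then have "h \<one>\<^bsub>G\<^esub> = 1"
    by auto
  then show ?thesis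
    using assms by (induction k) (simp_all add: char_group_mult)
qed

text \<open>
  The values of a character are roots of unity of order dividing \<open>order G\<close>, of which there are
  finitely many; extensionality excludes any freedom outside \<open>carrier G\<close>.
\<close>

lemma finite_char_group:
  assumes "group G" "finite (carrier G)"
  shows "finite (carrier (char_group G))"
proof (rule finite_subset)
  interpret group G by fact
  let ?U = "{z::complex. z ^ order G = 1}"
  have "order G > 0"
    using assms(2) order_gt_0_iff_finite by blast
  then show "finite (\<Pi>\<^sub>E x\<in>carrier G. ?U)"
    using assms(2) by (intro finite_PiE) (auto intro: finite_roots_unity)
  \<comment> \<open>The exponent \<open>0\<close> supplies \<open>h \<one> = 1\<close>.\<close>
  have "h x ^ order G = 1" if "h \<in> carrier (char_group G)" "x \<in> carrier G" for h x
    using that char_group_pow[OF assms(1), of h x "order G"]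
      char_group_pow[OF assms(1), of h x 0] pow_order_eq_1 by simp
  then show "carrier (char_group G) \<subseteq> (\<Pi>\<^sub>E x\<in>carrier G. ?U)"
    by (auto simp: PiE_iff char_group_def extensional_def)
qed

text \<open>
  Orthogonality: translation by \<open>a \<in> P\<close> permutes \<open>P\<close> and multiplies the sum of \<open>\<chi>\<close> by \<open>\<chi> a\<close>, so the
  sum vanishes as soon as some \<open>\<chi> a\<close> differs from \<open>1\<close>.
\<close>

lemma sum_multiplicative_subgroup:
  fixes \<chi> :: "'a \<Rightarrow> 'c :: field"
  assumes "group H" "subgroup P H" "finite P"
    and mult: "\<And>x y. x \<in> P \<Longrightarrow> y \<in> P \<Longrightarrow> \<chi> (x \<otimes>\<^bsub>H\<^esub> y) = \<chi> x * \<chi> y"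
  shows "(\<Sum>x\<in>P. \<chi> x) = (if \<forall>x\<in>P. \<chi> x = 1 then of_nat (card P) else 0)"
proof (cases "\<forall>x\<in>P. \<chi> x = 1")
  case False
  interpret group H by fact
  interpret P: subgroup P H by fact
  from False obtain a where a: "a \<in> P" "\<chi> a \<noteq> 1"
    by blast
  have inj: "inj_on (\<lambda>x. a \<otimes>\<^bsub>H\<^esub> x) P"
    using a by (auto intro!: inj_onI)
  have "(\<lambda>x. a \<otimes>\<^bsub>H\<^esub> x) ` P = P"
    using a inj assms(3) by (intro endo_inj_surj) auto
  then have "(\<Sum>x\<in>P. \<chi> x) = (\<Sum>x\<in>P. \<chi> (a \<otimes>\<^bsub>H\<^esub> x))"
    using sum.reindex[OF inj, of \<chi>] by simp
  also have "\<dots> = \<chi> a * (\<Sum>x\<in>P. \<chi> x)"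
    using a by (simp add: mult sum_distrib_left)
  finally show ?thesis
    using a False by auto
qed simp

lemma finite_matrix_indices: "finite (matrix_indices s n)"
  by (simp add: matrix_indices_def)

lemma carrier_matrix_group:
  "carrier (matrix_group s n G) = (\<Pi>\<^sub>E ij\<in>matrix_indices s n. carrier G)"
  by (simp add: matrix_group_def)

lemma finite_matrix_group:
  "finite (carrier G) \<Longrightarrow> finite (carrier (matrix_group s n G))"
  by (simp add: carrier_matrix_group finite_PiE finite_matrix_indices)

lemma matrix_pairing_eq_prod:
  "matrix_pairing s n A B = (\<Prod>ij\<in>matrix_indices s n. pairing (A ij) (B ij))"
  by (simp add: matrix_pairing_def case_prod_beta)

lemma matrix_pairing_mult:
  assumes "A \<in> carrier (matrix_group s n (char_group G))"
    and "B \<in> carrier (matrix_group s n G)" "C \<in> carrier (matrix_group s n G)"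
  shows "matrix_pairing s n A (B \<otimes>\<^bsub>matrix_group s n G\<^esub> C) =
    matrix_pairing s n A B * matrix_pairing s n A C"
proof -
  have "pairing (A ij) (B ij \<otimes>\<^bsub>G\<^esub> C ij) = pairing (A ij) (B ij) * pairing (A ij) (C ij)"
    if "ij \<in> matrix_indices s n" for ij
    using assms that unfolding pairing_def carrier_matrix_group
    by (intro char_group_mult) auto
  then show ?thesis
    by (simp add: matrix_pairing_eq_prod matrix_group_def prod.distrib)
qed

lemma sum_matrix_pairing:
  assumes "group G" "finite (carrier G)" "subgroup P (matrix_group s n G)"
    and "A \<in> carrier (matrix_group s n (char_group G))"
  shows "(\<Sum>B\<in>P. matrix_pairing s n A B) =
    (if A \<in> annihilator s n G P then of_nat (card P) else 0)"
proof -
  have sub: "P \<subseteq> carrier (matrix_group s n G)"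
    using assms(3) by (rule subgroup.subset)
  moreover have "finite (carrier (matrix_group s n G))"
    using assms(2) by (rule finite_matrix_group)
  ultimately have "finite P"
    by (rule finite_subset)
  moreover have "group (matrix_group s n G)"
    unfolding matrix_group_def using assms(1) by simp
  ultimately have "(\<Sum>B\<in>P. matrix_pairing s n A B) =
      (if \<forall>B\<in>P. matrix_pairing s n A B = 1 then of_nat (card P) else 0)"
    using assms(3) sub
    by (intro sum_multiplicative_subgroup[of "matrix_group s n G"] matrix_pairing_mult[OF assms(4)])
      auto
  then show ?thesis
    using assms(4) by (simp add: annihilator_def)
qed

theorem proposition4p1:
  fixes G :: "('a, 'b) monoid_scheme"
    and s n :: nat
    and P :: "(nat \<times> nat \<Rightarrow> 'a) set"
  assumes "s > 0" and "n > 0"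
    and "comm_group G" and "finite (carrier G)"
    and "subgroup P (matrix_group s n G)"
  shows "weight_enumerator s n (annihilator s n G P) =
    mpoly_const (1 / of_nat (card P)) *
    mpoly_subst
      (\<lambda>(i, j, g). \<Sum>h\<in>carrier (char_group G). mpoly_const (pairing h g) * mpoly_var (i, j, h))
      (weight_enumerator s n P)"
proof -
  interpret comm_group G by fact
  define I where "I = matrix_indices s n"
  define \<sigma> :: "nat \<times> nat \<times> 'a \<Rightarrow> (nat \<times> nat \<times> ('a \<Rightarrow> complex)) complex_mpoly"
    where "\<sigma> = (\<lambda>(i, j, g). \<Sum>h\<in>carrier (char_group G).
      mpoly_const (pairing h g) * mpoly_var (i, j, h))"
  define mon :: "(nat \<times> nat \<Rightarrow> 'a \<Rightarrow> complex) \<Rightarrow> (nat \<times> nat \<times> ('a \<Rightarrow> complex)) complex_mpoly"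
    where "mon A = (\<Prod>(i, j)\<in>I. mpoly_var (i, j, A (i, j)))" for A
  let ?M = "carrier (matrix_group s n (char_group G))"
  have fin_I: "finite I"
    by (simp add: I_def finite_matrix_indices)
  have fin_char: "finite (carrier (char_group G))"
    using assms(4) is_group by (rule finite_char_group[rotated])
  have fin_M: "finite ?M"
    using fin_char by (rule finite_matrix_group)
  have "finite P"
    using subgroup.subset[OF assms(5)] finite_matrix_group[OF assms(4)] by (rule finite_subset)
  moreover have "P \<noteq> {}"
    using subgroup.one_closed[OF assms(5)] by blast
  ultimately have card_P: "card P \<noteq> 0"
    by simp

  \<comment> \<open>Multiplying out the substituted monomial: a choice of one character per position is a matrix
    of characters.\<close>
  have subst_monomial: "mpoly_subst \<sigma> (\<Prod>(i, j)\<in>I. mpoly_var (i, j, B (i, j))) =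
      (\<Sum>A\<in>?M. mpoly_const (matrix_pairing s n A B) * mon A)" for B
  proof -
    have "inj_on (\<lambda>(i, j). (i, j, B (i, j))) I"
      by (auto simp: inj_on_def)
    then have "mpoly_subst \<sigma> (\<Prod>(i, j)\<in>I. mpoly_var (i, j, B (i, j))) =
        (\<Prod>(i, j)\<in>I. \<sigma> (i, j, B (i, j)))"
      using mpoly_subst_squarefree[OF fin_I, of "\<lambda>(i, j). (i, j, B (i, j))" \<sigma>]
      by (simp add: case_prod_unfold)
    also have "\<dots> = (\<Prod>ij\<in>I. \<Sum>h\<in>carrier (char_group G).
        mpoly_const (pairing h (B ij)) * mpoly_var (fst ij, snd ij, h))"
      by (simp add: \<sigma>_def case_prod_unfold)
    also have "\<dots> = (\<Sum>A\<in>?M. \<Prod>ij\<in>I.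
        mpoly_const (pairing (A ij) (B ij)) * mpoly_var (fst ij, snd ij, A ij))"
      using fin_I fin_char by (simp add: carrier_matrix_group prod_sum_PiE flip: I_def)
    also have "\<dots> = (\<Sum>A\<in>?M. mpoly_const (matrix_pairing s n A B) * mon A)"
      by (simp add: prod.distrib mon_def matrix_pairing_eq_prod mpoly_const_prod case_prod_unfold
          flip: I_def)
    finally show ?thesis .
  qed

  have "mpoly_const (1 / of_nat (card P)) * mpoly_subst \<sigma> (weight_enumerator s n P) =
      mpoly_const (1 / of_nat (card P)) *
        (\<Sum>B\<in>P. \<Sum>A\<in>?M. mpoly_const (matrix_pairing s n A B) * mon A)"
    by (simp add: weight_enumerator_def mpoly_subst_sum subst_monomial flip: I_def)
  also have "\<dots> = (\<Sum>A\<in>?M.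
      mpoly_const (1 / of_nat (card P) * (\<Sum>B\<in>P. matrix_pairing s n A B)) * mon A)"
    by (subst sum.swap)
      (simp add: mpoly_const_mult mpoly_const_sum sum_distrib_left sum_distrib_right mult.assoc
        del: times_divide_eq_left)
  also have "\<dots> = (\<Sum>A\<in>?M. if A \<in> annihilator s n G P then mon A else 0)"
    using card_P by (intro sum.cong) (simp_all add: sum_matrix_pairing[OF is_group assms(4,5)])
  also have "\<dots> = (\<Sum>A\<in>?M \<inter> annihilator s n G P. mon A)"
    using fin_M by (simp add: sum.inter_restrict)
  also have "?M \<inter> annihilator s n G P = annihilator s n G P"
    by (auto simp: annihilator_def)
  also have "(\<Sum>A\<in>annihilator s n G P. mon A) = weight_enumerator s n (annihilator s n G P)"
    by (simp add: weight_enumerator_def mon_def I_def)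
  finally show ?thesis
    unfolding \<sigma>_def by (rule sym)
qed

end
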